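(* Consider a basis market with $n\in\{1,2,\dots\}$ driving independent Brownian motions in which the entropy $\mathcal{H}(\bar q_\infty)$ of the stationary joint density of the normalized GOPs is maximized, so that the normalized GOPs have the entropy-maximizing dynamics described in the context. Suppose that only the market activity $$a=\left(\frac1n\sum_{j=1}^n\sqrt{a^j}\right)^2$$ is fixed, but not the individual activities $a^1,\dots,a^n$. Then, for $t\in(0,\infty)$, the maximum (over the individual activities with the given market activity $a$) of the relative entropy $\mathcal{H}(\bar q_\infty,\Lambda_t)$ is $$\mathcal{H}(\bar q_\infty,\Lambda_t)=-n\,a\,t,$$ and it emerges when all individual activities equal the market activity, i.e. $a^j=a$ for all $j\in\{1,\dots,n\}$.
   Context: Work on a filtered probability space satisfying the usual conditions, with independent standard Brownian motions $W^1,\dots,W^n$. The growth optimal portfolio (GOP) of the market is assumed to exist; benchmarked means denominated in units of the GOP. Basis market. A basis market is a continuous market formed by $n+1$ independent benchmarked basis security accounts $\hat B^1,\dots,\hat B^{n+1}$, where $\hat B^{n+1}_t=1$ and, for $j\in\{1,\dots,n\}$, $$\frac{d\hat B^j_t}{\hat B^j_t}=-\theta^j_t\,dW^j_t,\qquad \hat B^j_0=1,$$ with $\theta^j$ a square-integrable, predictable, stationary process (the $j$-th basis volatility). Normalized GOPs. For $j\in\{1,\dots,n\}$ the $j$-th activity time is $\tau^j_t=\tau^j_0+a^jt$ with constant activity $a^j>0$, and the $j$-th normalized GOP is $Y^j_{\tau^j_t}=(\hat B^j_t)^{-1}e^{-\tau^j_t}$, so $Y^j_{\tau^j_0}=e^{-\tau^j_0}$.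 Entropy-maximizing dynamics. With $\bar Y=2e^{\gamma_E-1}$ ($\gamma_E$ the Euler-Mascheroni constant), the $j$-th normalized GOP is the stationary solution of $$dY^j_{\tau^j_t}=(\bar Y-Y^j_{\tau^j_t})\,d\tau^j_t+\sqrt{Y^j_{\tau^j_t}\bar Y}\,d\bar W^j_{\tau^j_t},\qquad d\bar W^j_{\tau^j_t}=\sqrt{a^j}\,dW^j_t,$$ with initial value distributed according to its stationary density $\bar q^j_\infty(y)=(2/\bar Y)^2\,y\,e^{-2y/\bar Y}$, $y>0$, and the basis volatility is $$\theta^j_t=\sqrt{\frac{a^j\bar Y}{Y^j_{\tau^j_t}}},\qquad\text{so that}\qquad a^j=\tfrac12\mathbf{E}^{\bar q^j_\infty}((\theta^j_t)^2).$$ Here $\mathbf{E}^{\bar q^j_\infty}$ denotes expectation under stationarity with density $\bar q^j_\infty$. The normalized GOPs are independent and $\bar q_\infty=\prod_{j=1}^n\bar q^j_\infty$. Relative entropy. The Radon-Nikodym density is $$\Lambda_t=\prod_{j=1}^n\hat B^j_t=\prod_{j=1}^n\frac{1}{e^{\tau^j_t}Y^j_{\tau^j_t}} .$$ The relative entropy of $\Lambda_t$ with respect to $\bar q_\infty$ is $$\mathcal{H}(\bar q_\infty,\Lambda_t)=\sum_{j=1}^n\mathbf{E}^{\bar q^j_\infty}\left(\ln\frac{\hat B^j_t}{\hat B^j_0}\right).$$ *)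

theory Defs
  imports "HOL-Probability.Probability"
begin

section \<open>Filtered probability spaces and Brownian motions\<close>

text \<open>Processes are curried, \<open>X t \<omega>\<close>; only times \<open>t \<ge> 0\<close> matter. The library locale \<open>filtration\<close> is
  instantiated at index type \<open>real\<close>, so \<open>F\<close> also has values at negative times, which are sub-sigma-algebras
  of \<open>F 0\<close> and are never used otherwise.\<close>

definition usual_filtered_prob_space :: "'w measure \<Rightarrow> (real \<Rightarrow> 'w measure) \<Rightarrow> bool" where
  "usual_filtered_prob_space M F \<longleftrightarrow>
     prob_space M \<and> filtration (space M) F \<and> (\<forall>t. subalgebra M (F t)) \<and>
     (\<forall>N\<in>null_sets M. \<forall>A\<subseteq>N. A \<in> sets (F 0)) \<and>
     (\<forall>t\<ge>0. (\<Inter>s\<in>{t<..}. sets (F s)) = sets (F t))"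

definition adapted_process :: "(real \<Rightarrow> 'w measure) \<Rightarrow> (real \<Rightarrow> 'w \<Rightarrow> real) \<Rightarrow> bool" where
  "adapted_process F X \<longleftrightarrow> (\<forall>t\<ge>0. X t \<in> borel_measurable (F t))"

definition continuous_process :: "'w measure \<Rightarrow> (real \<Rightarrow> 'w \<Rightarrow> real) \<Rightarrow> bool" where
  "continuous_process M X \<longleftrightarrow> (AE \<omega> in M. continuous_on {0..} (\<lambda>t. X t \<omega>))"

definition stationary_process :: "'w measure \<Rightarrow> (real \<Rightarrow> 'w \<Rightarrow> real) \<Rightarrow> bool" where
  "stationary_process M X \<longleftrightarrow>
     (\<forall>t\<ge>0. X t \<in> borel_measurable M) \<and>
     (\<forall>h\<ge>0. distr M (PiM {0..} (\<lambda>_. borel)) (\<lambda>\<omega>. \<lambda>t\<in>{0..}. X (t + h) \<omega>)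
           = distr M (PiM {0..} (\<lambda>_. borel)) (\<lambda>\<omega>. \<lambda>t\<in>{0..}. X t \<omega>))"

definition independent_processes ::
    "'w measure \<Rightarrow> 'i set \<Rightarrow> ('i \<Rightarrow> real \<Rightarrow> 'w \<Rightarrow> real) \<Rightarrow> bool" where
  "independent_processes M I X \<longleftrightarrow>
     prob_space.indep_vars M (\<lambda>_. PiM {0..} (\<lambda>_. borel)) (\<lambda>i \<omega>. \<lambda>t\<in>{0..}. X i t \<omega>) I"

text \<open>Independent standard Brownian motions \<open>W 1, \<dots>, W n\<close> relative to \<open>F\<close>: the vector of increments
  after time \<open>s\<close> is independent of \<open>F s\<close> and has independent centred normal components.\<close>

definition standard_brownian_motions ::
    "'w measure \<Rightarrow> (real \<Rightarrow> 'w measure) \<Rightarrow> nat \<Rightarrow> (nat \<Rightarrow> real \<Rightarrow> 'w \<Rightarrow> real) \<Rightarrow> bool" where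
  "standard_brownian_motions M F n W \<longleftrightarrow>
     (\<forall>j\<in>{1..n}. adapted_process F (W j) \<and> continuous_process M (W j) \<and> (AE \<omega> in M. W j 0 \<omega> = 0)) \<and>
     independent_processes M {1..n} W \<and>
     (\<forall>s t. 0 \<le> s \<and> s < t \<longrightarrow>
        (\<forall>j\<in>{1..n}. distributed M lborel (\<lambda>\<omega>. W j t \<omega> - W j s \<omega>) (normal_density 0 (sqrt (t - s)))) \<and>
        prob_space.indep_vars M (\<lambda>_. borel) (\<lambda>j \<omega>. W j t \<omega> - W j s \<omega>) {1..n} \<and>
        prob_space.indep_set M (sets (F s))
          (sets (vimage_algebra (space M) (\<lambda>\<omega>. \<lambda>j\<in>{1..n}. W j t \<omega> - W j s \<omega>)
                   (PiM {1..n} (\<lambda>_. borel)))))"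

section \<open>Stochastic integration\<close>

definition predictable_algebra :: "'w measure \<Rightarrow> (real \<Rightarrow> 'w measure) \<Rightarrow> (real \<times> 'w) measure" where
  "predictable_algebra M F =
     sigma ({0..} \<times> space M)
       ({{0} \<times> A |A. A \<in> sets (F 0)} \<union> {{s<..t} \<times> A |s t A. 0 \<le> s \<and> s \<le> t \<and> A \<in> sets (F s)})"

definition predictable_process ::
    "'w measure \<Rightarrow> (real \<Rightarrow> 'w measure) \<Rightarrow> (real \<Rightarrow> 'w \<Rightarrow> real) \<Rightarrow> bool" where
  "predictable_process M F H \<longleftrightarrow> (\<lambda>(t, \<omega>). H t \<omega>) \<in> borel_measurable (predictable_algebra M F)"

text \<open>A simple integrand is given by a grid \<open>0 \<le> p 0 \<le> \<dots> \<le> p m\<close> and bounded \<open>F (p i)\<close>-measurable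
  values \<open>\<xi> i\<close> on the intervals \<open>{p i<..p (Suc i)}\<close>.\<close>

definition simple_integrand ::
    "'w measure \<Rightarrow> (real \<Rightarrow> 'w measure) \<Rightarrow> nat \<Rightarrow> (nat \<Rightarrow> real) \<Rightarrow> (nat \<Rightarrow> 'w \<Rightarrow> real) \<Rightarrow> bool" where
  "simple_integrand M F m p \<xi> \<longleftrightarrow>
     0 \<le> p 0 \<and> (\<forall>i<m. p i \<le> p (Suc i)) \<and>
     (\<forall>i<m. \<xi> i \<in> borel_measurable (F (p i)) \<and> (\<exists>C. \<forall>\<omega>\<in>space M. \<bar>\<xi> i \<omega>\<bar> \<le> C))"

definition simple_process :: "nat \<Rightarrow> (nat \<Rightarrow> real) \<Rightarrow> (nat \<Rightarrow> 'w \<Rightarrow> real) \<Rightarrow> real \<Rightarrow> 'w \<Rightarrow> real" where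
  "simple_process m p \<xi> t \<omega> = (\<Sum>i<m. \<xi> i \<omega> * indicator {p i<..p (Suc i)} t)"

definition simple_integral ::
    "(real \<Rightarrow> 'w \<Rightarrow> real) \<Rightarrow> nat \<Rightarrow> (nat \<Rightarrow> real) \<Rightarrow> (nat \<Rightarrow> 'w \<Rightarrow> real) \<Rightarrow> real \<Rightarrow> 'w \<Rightarrow> real" where
  "simple_integral W m p \<xi> t \<omega> =
     (\<Sum>i<m. \<xi> i \<omega> * (W (min (p (Suc i)) t) \<omega> - W (min (p i) t) \<omega>))"

text \<open>\<open>has_ito_integral M F W H I\<close>: the process \<open>I\<close> is (a continuous version of) the Ito integral
  \<open>t \<mapsto> \<integral>\<^sub>0\<^sup>t H dW\<close> of the predictable, pathwise locally square-integrable \<open>H\<close>, namely the limit, uniformly on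
  compacts in probability, of integrals of simple integrands approximating \<open>H\<close> in \<open>L\<^sup>2[0,T]\<close> in probability.\<close>

definition has_ito_integral ::
    "'w measure \<Rightarrow> (real \<Rightarrow> 'w measure) \<Rightarrow> (real \<Rightarrow> 'w \<Rightarrow> real) \<Rightarrow> (real \<Rightarrow> 'w \<Rightarrow> real)
      \<Rightarrow> (real \<Rightarrow> 'w \<Rightarrow> real) \<Rightarrow> bool" where
  "has_ito_integral M F W H I \<longleftrightarrow>
     predictable_process M F H \<and>
     (AE \<omega> in M. \<forall>T\<ge>0. set_integrable lborel {0..T} (\<lambda>s. (H s \<omega>)\<^sup>2)) \<and>
     adapted_process F I \<and> continuous_process M I \<and>
     (\<exists>m p \<xi>. (\<forall>k::nat. simple_integrand M F (m k) (p k) (\<xi> k)) \<and>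
        (\<forall>T\<ge>0. \<forall>\<epsilon>>0.
           (\<lambda>k. measure M {\<omega>\<in>space M.
              \<epsilon> < (LBINT s:{0..T}. (simple_process (m k) (p k) (\<xi> k) s \<omega> - H s \<omega>)\<^sup>2)}) \<longlonglongrightarrow> 0 \<and>
           (\<lambda>k. measure M {\<omega>\<in>space M.
              \<exists>s\<in>{0..T}. \<epsilon> < \<bar>simple_integral W (m k) (p k) (\<xi> k) s \<omega> - I s \<omega>\<bar>}) \<longlonglongrightarrow> 0))"

text \<open>\<open>dX\<^sub>t = \<mu>\<^sub>t dt + \<sigma>\<^sub>t dW\<^sub>t\<close> on \<open>[0,\<infinity>)\<close>.\<close>

definition ito_differential ::
    "'w measure \<Rightarrow> (real \<Rightarrow> 'w measure) \<Rightarrow> (real \<Rightarrow> 'w \<Rightarrow> real) \<Rightarrow> (real \<Rightarrow> 'w \<Rightarrow> real)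
      \<Rightarrow> (real \<Rightarrow> 'w \<Rightarrow> real) \<Rightarrow> (real \<Rightarrow> 'w \<Rightarrow> real) \<Rightarrow> bool" where
  "ito_differential M F W X \<mu> \<sigma> \<longleftrightarrow>
     adapted_process F X \<and> continuous_process M X \<and>
     (AE \<omega> in M. \<forall>T\<ge>0. set_integrable lborel {0..T} (\<lambda>s. \<mu> s \<omega>)) \<and>
     (\<exists>I. has_ito_integral M F W \<sigma> I \<and>
        (AE \<omega> in M. \<forall>t\<ge>0. X t \<omega> = X 0 \<omega> + (LBINT s:{0..t}. \<mu> s \<omega>) + I t \<omega>))"

section \<open>Basis markets\<close>

text \<open>All security accounts are benchmarked, i.e. already denominated in units of the growth optimal portfolio.
  The equation \<open>dB/B = - \<theta> dW\<close> is stated as \<open>dB = - B \<theta> dW\<close> with \<open>B > 0\<close>.\<close>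

definition basis_market ::
    "'w measure \<Rightarrow> (real \<Rightarrow> 'w measure) \<Rightarrow> (nat \<Rightarrow> real \<Rightarrow> 'w \<Rightarrow> real) \<Rightarrow> nat
      \<Rightarrow> (nat \<Rightarrow> real \<Rightarrow> 'w \<Rightarrow> real) \<Rightarrow> (nat \<Rightarrow> real \<Rightarrow> 'w \<Rightarrow> real) \<Rightarrow> bool" where
  "basis_market M F W n \<theta> B \<longleftrightarrow>
     independent_processes M {1..n+1} B \<and>
     (\<forall>t\<ge>0. \<forall>\<omega>\<in>space M. B (n + 1) t \<omega> = 1) \<and>
     (\<forall>j\<in>{1..n}.
        predictable_process M F (\<theta> j) \<and> stationary_process M (\<theta> j) \<and>
        (\<forall>t\<ge>0. integrable M (\<lambda>\<omega>. (\<theta> j t \<omega>)\<^sup>2)) \<and>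
        (AE \<omega> in M. B j 0 \<omega> = 1) \<and> (AE \<omega> in M. \<forall>t\<ge>0. 0 < B j t \<omega>) \<and>
        ito_differential M F (W j) (B j) (\<lambda>_ _. 0) (\<lambda>t \<omega>. - (B j t \<omega> * \<theta> j t \<omega>)))"

definition Y_bar :: real where
  "Y_bar = 2 * exp (euler_mascheroni - 1)"

definition stationary_density :: "real \<Rightarrow> real" where
  "stationary_density y = (if 0 < y then (2 / Y_bar)\<^sup>2 * y * exp (- 2 * y / Y_bar) else 0)"

text \<open>The process \<open>Y j\<close> is indexed by activity time. Since \<open>Y j\<close> at the initial activity time equals
  \<open>exp (- \<tau> j 0)\<close> and is distributed according to the stationary density, the initial activity time
  is an \<open>F 0\<close>-measurable random variable rather than a constant.
  The dynamics are written in market time, using \<open>d\<tau> = \<alpha> j dt\<close> and the relation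
  \<open>sqrt (\<alpha> j) dW\<close> for the increments of the Brownian motion in activity time.\<close>

definition entropy_maximizing_basis_market ::
    "'w measure \<Rightarrow> (real \<Rightarrow> 'w measure) \<Rightarrow> (nat \<Rightarrow> real \<Rightarrow> 'w \<Rightarrow> real) \<Rightarrow> nat \<Rightarrow> (nat \<Rightarrow> real)
      \<Rightarrow> (nat \<Rightarrow> real \<Rightarrow> 'w \<Rightarrow> real) \<Rightarrow> (nat \<Rightarrow> real \<Rightarrow> 'w \<Rightarrow> real)
      \<Rightarrow> (nat \<Rightarrow> real \<Rightarrow> 'w \<Rightarrow> real) \<Rightarrow> (nat \<Rightarrow> real \<Rightarrow> 'w \<Rightarrow> real) \<Rightarrow> bool" where
  "entropy_maximizing_basis_market M F W n \<alpha> \<theta> B \<tau> Y \<longleftrightarrow>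
     basis_market M F W n \<theta> B \<and>
     independent_processes M {1..n} (\<lambda>j t \<omega>. Y j (\<tau> j t \<omega>) \<omega>) \<and>
     (\<forall>j\<in>{1..n}.
        0 < \<alpha> j \<and>
        \<tau> j 0 \<in> borel_measurable (F 0) \<and>
        (\<forall>t\<ge>0. \<forall>\<omega>\<in>space M. \<tau> j t \<omega> = \<tau> j 0 \<omega> + \<alpha> j * t) \<and>
        (AE \<omega> in M. \<forall>t\<ge>0. Y j (\<tau> j t \<omega>) \<omega> = inverse (B j t \<omega>) * exp (- \<tau> j t \<omega>)) \<and>
        ito_differential M F (W j) (\<lambda>t \<omega>. Y j (\<tau> j t \<omega>) \<omega>)
          (\<lambda>t \<omega>. (Y_bar - Y j (\<tau> j t \<omega>) \<omega>) * \<alpha> j)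
          (\<lambda>t \<omega>. sqrt (Y j (\<tau> j t \<omega>) \<omega> * Y_bar) * sqrt (\<alpha> j)) \<and>
        stationary_process M (\<lambda>t \<omega>. Y j (\<tau> j t \<omega>) \<omega>) \<and>
        distributed M lborel (\<lambda>\<omega>. Y j (\<tau> j 0 \<omega>) \<omega>) stationary_density \<and>
        (AE \<omega> in M. \<forall>t\<ge>0. \<theta> j t \<omega> = sqrt (\<alpha> j * Y_bar / Y j (\<tau> j t \<omega>) \<omega>)))"

section \<open>Market activity and relative entropy\<close>

definition market_activity :: "nat \<Rightarrow> (nat \<Rightarrow> real) \<Rightarrow> real" where
  "market_activity n \<alpha> = (1 / real n * (\<Sum>j=1..n. sqrt (\<alpha> j)))\<^sup>2"

definition activity_vectors :: "nat \<Rightarrow> real \<Rightarrow> (nat \<Rightarrow> real) set" where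
  "activity_vectors n a = {\<alpha> \<in> {1..n} \<rightarrow>\<^sub>E {0<..}. market_activity n \<alpha> = a}"

text \<open>Relative entropy of the Radon-Nikodym density \<open>\<Lambda>\<^sub>t = (\<Prod>j=1..n. B j t)\<close>. In an entropy-maximizing
  basis market the normalized GOPs are stationary with density \<open>stationary_density\<close> under \<open>M\<close>, so the
  expectation under stationarity is the one with respect to \<open>M\<close>.\<close>

definition relative_entropy :: "'w measure \<Rightarrow> nat \<Rightarrow> (nat \<Rightarrow> real \<Rightarrow> 'w \<Rightarrow> real) \<Rightarrow> real \<Rightarrow> real" where
  "relative_entropy M n B t = (\<Sum>j=1..n. \<integral>\<omega>. ln (B j t \<omega> / B j 0 \<omega>) \<partial>M)"

end

theory Submission
  imports Defs
begin

text \<open>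
  The result combines a cancellation due to stationarity with an inequality between means.

  Taking logarithms in \<open>Y j (\<tau> j t) = inverse (B j t) * exp (- \<tau> j t)\<close> at times \<open>0\<close> and \<open>t\<close> and subtracting, the
  random initial activity time drops out:
  \<open>ln (B j t / B j 0) = ln (Y j (\<tau> j 0)) - ln (Y j (\<tau> j t)) - \<alpha> j * t\<close>.
  As the normalized GOP is stationary, the two logarithms have the same expectation, and what is left is
  \<open>- \<alpha> j * t\<close> (\<open>expected_log_growth\<close>). The cancellation is legitimate because this common expectation is
  finite: the stationary density is that of a Gamma distribution with shape \<open>2\<close>, for which both \<open>y\<close> and
  \<open>1 / y\<close>, and hence \<open>ln y\<close>, are integrable (\<open>integrable_ln_stationary_density\<close>).

  The relative entropy is therefore \<open>- t\<close> times the sum of the activities. Fixing the market activity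
  fixes the mean of the numbers \<open>sqrt (\<alpha> j)\<close>, and the sum of their squares is then smallest when all of
  them agree (\<open>market_activity_le_mean\<close>).
\<close>

lemma Y_bar_pos: "Y_bar > 0"
  by (simp add: Y_bar_def)

lemma stationary_density_eq_erlang:
  "stationary_density y = erlang_density 1 (2 / Y_bar) y"
  by (auto simp: stationary_density_def erlang_density_def power2_eq_square)

text \<open>Elementary from \<open>ln u \<le> u - 1\<close>, applied to \<open>y\<close> and to \<open>1 / y\<close>.\<close>

lemma abs_ln_le_add_inverse:
  fixes y :: real
  assumes "y > 0"
  shows "\<bar>ln y\<bar> \<le> y + 1 / y"
proof -
  have "ln y \<le> y - 1" using assms by (rule ln_le_minus_one)
  moreover have "ln (1 / y) \<le> 1 / y - 1" using assms by (intro ln_le_minus_one) simp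
  moreover have "ln (1 / y) = - ln y" using assms by (simp add: ln_div)
  moreover have "1 / y > 0" using assms by simp
  ultimately show ?thesis using assms by linarith
qed

lemma integrable_erlang_density:
  assumes "0 < l"
  shows "integrable lborel (erlang_density k l)"
proof (rule integrableI_nonneg)
  have "(\<integral>\<^sup>+ x. erlang_density k l x \<partial>lborel) = 1"
    using prob_space.emeasure_space_1[OF prob_space_erlang_density[OF assms, of k]]
    by (simp add: emeasure_density)
  then show "(\<integral>\<^sup>+ x. erlang_density k l x \<partial>lborel) < \<infinity>" by simp
qed (use assms in auto)

text \<open>Multiplying the Gamma density of shape \<open>2\<close> by \<open>y\<close> or by \<open>1 / y\<close> gives, up to a constant, the Gamma
  densities of shape \<open>3\<close> and \<open>1\<close>. Their sum dominates the logarithm.\<close>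

lemma integrable_ln_stationary_density:
  "integrable lborel (\<lambda>y. stationary_density y * ln y)"
proof (rule Bochner_Integration.integrable_bound)
  define l where "l = 2 / Y_bar"
  have l: "l > 0" using Y_bar_pos by (simp add: l_def)
  show "integrable lborel (\<lambda>y. 2 / l * erlang_density 2 l y + l * erlang_density 0 l y)"
    by (intro Bochner_Integration.integrable_add integrable_mult_right integrable_erlang_density l)
  show "(\<lambda>y. stationary_density y * ln y) \<in> borel_measurable lborel"
    unfolding stationary_density_def by measurable
  have "\<bar>stationary_density y * ln y\<bar> \<le> 2 / l * erlang_density 2 l y + l * erlang_density 0 l y" for y
  proof (cases "y > 0")
    case True
    have "\<bar>stationary_density y * ln y\<bar> = stationary_density y * \<bar>ln y\<bar>"
      using True by (simp add: abs_mult stationary_density_def)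
    also have "\<dots> \<le> stationary_density y * (y + 1 / y)"
      using True by (intro mult_left_mono abs_ln_le_add_inverse) (simp_all add: stationary_density_def)
    also have "\<dots> = 2 / l * erlang_density 2 l y + l * erlang_density 0 l y"
      using True l
      by (simp add: stationary_density_eq_erlang erlang_density_def l_def[symmetric] distrib_left
          power2_eq_square power3_eq_cube)
    finally show ?thesis .
  next
    case False
    then show ?thesis using l by (simp add: stationary_density_def)
  qed
  then show "AE y in lborel. norm (stationary_density y * ln y)
      \<le> norm (2 / l * erlang_density 2 l y + l * erlang_density 0 l y)"
    unfolding real_norm_def by (intro AE_I2 order_trans[OF _ abs_ge_self])
qed

text \<open>Stationarity is an identity of laws on path space; evaluation at time \<open>0\<close> turns it into one of
  marginal laws.\<close>

lemma stationary_process_distr_eq: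
  assumes "stationary_process M X" "0 \<le> t"
  shows "distr M borel (X t) = distr M borel (X 0)"
proof -
  let ?P = "PiM {0::real..} (\<lambda>_. borel :: real measure)"
  let ?path = "\<lambda>h \<omega>. \<lambda>s\<in>{0::real..}. X (s + h) \<omega>"
  have X: "X s \<in> borel_measurable M" if "0 \<le> s" for s
    using assms(1) that by (simp add: stationary_process_def)
  have path: "?path h \<in> measurable M ?P" if "0 \<le> h" for h
    using X that by (intro measurable_restrict) auto
  have marginal: "distr (distr M ?P (?path h)) borel (\<lambda>f. f 0) = distr M borel (X h)" if "0 \<le> h" for h
    using path[OF that] by (subst distr_distr) (auto simp: comp_def intro!: measurable_component_singleton)
  have "distr M ?P (?path t) = distr M ?P (?path 0)"
    using assms by (simp add: stationary_process_def)
  then show ?thesis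
    using marginal[of t] marginal[of 0] assms(2) by simp
qed

lemma stationary_process_comp:
  fixes g :: "real \<Rightarrow> real"
  assumes "stationary_process M X" "0 \<le> t" "g \<in> borel_measurable borel"
  shows "integrable M (\<lambda>\<omega>. g (X t \<omega>)) \<longleftrightarrow> integrable M (\<lambda>\<omega>. g (X 0 \<omega>))"
    and "(\<integral>\<omega>. g (X t \<omega>) \<partial>M) = (\<integral>\<omega>. g (X 0 \<omega>) \<partial>M)"
proof -
  have X: "X t \<in> borel_measurable M" "X 0 \<in> borel_measurable M"
    using assms by (simp_all add: stationary_process_def)
  note eq = stationary_process_distr_eq[OF assms(1,2)]
  show "integrable M (\<lambda>\<omega>. g (X t \<omega>)) \<longleftrightarrow> integrable M (\<lambda>\<omega>. g (X 0 \<omega>))"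
    using integrable_distr_eq[OF X(1) assms(3)] integrable_distr_eq[OF X(2) assms(3)] eq by simp
  show "(\<integral>\<omega>. g (X t \<omega>) \<partial>M) = (\<integral>\<omega>. g (X 0 \<omega>) \<partial>M)"
    using integral_distr[OF X(1) assms(3)] integral_distr[OF X(2) assms(3)] eq by simp
qed

text \<open>Here the random initial activity time and, by stationarity, both logarithms of the normalized GOP
  cancel, so that only the deterministic drift of the activity time survives.\<close>

lemma expected_log_growth:
  assumes "usual_filtered_prob_space M F"
    and "entropy_maximizing_basis_market M F W n \<alpha> \<theta> B \<tau> Y"
    and "j \<in> {1..n}" "0 \<le> t"
  shows "(\<integral>\<omega>. ln (B j t \<omega> / B j 0 \<omega>) \<partial>M) = - \<alpha> j * t"
proof -
  interpret prob_space M
    using assms(1) by (simp add: usual_filtered_prob_space_def)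
  define Z where "Z = (\<lambda>t \<omega>. Y j (\<tau> j t \<omega>) \<omega>)"
  have market: "basis_market M F W n \<theta> B"
    using assms(2) unfolding entropy_maximizing_basis_market_def by (rule conjunct1)
  have stat: "stationary_process M Z"
    and dist: "distributed M lborel (Z 0) stationary_density"
    and Z_eq: "AE \<omega> in M. \<forall>t\<ge>0. Z t \<omega> = inverse (B j t \<omega>) * exp (- \<tau> j t \<omega>)"
    and \<tau>: "\<forall>t\<ge>0. \<forall>\<omega>\<in>space M. \<tau> j t \<omega> = \<tau> j 0 \<omega> + \<alpha> j * t"
    using assms(2,3) unfolding entropy_maximizing_basis_market_def Z_def by blast+
  have B_pos: "AE \<omega> in M. \<forall>t\<ge>0. 0 < B j t \<omega>"
    and B_adapted: "adapted_process F (B j)"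
    using market assms(3) unfolding basis_market_def ito_differential_def by blast+
  have B_meas: "B j s \<in> borel_measurable M" if "0 \<le> s" for s
  proof (rule measurable_from_subalg)
    show "subalgebra M (F s)"
      using assms(1) by (simp add: usual_filtered_prob_space_def)
    show "B j s \<in> borel_measurable (F s)"
      using B_adapted that by (simp add: adapted_process_def)
  qed
  have Z_meas: "Z s \<in> borel_measurable M" if "0 \<le> s" for s
    using stat that by (simp add: stationary_process_def)
  have int_0: "integrable M (\<lambda>\<omega>. ln (Z 0 \<omega>))"
    using integrable_ln_stationary_density
    by (subst distributed_integrable[OF dist, symmetric]) (auto simp: stationary_density_def)
  then have int_t: "integrable M (\<lambda>\<omega>. ln (Z t \<omega>))"
    using stationary_process_comp(1)[OF stat assms(4), of ln] by simp
  have "AE \<omega> in M. ln (B j t \<omega> / B j 0 \<omega>) = ln (Z 0 \<omega>) - ln (Z t \<omega>) - \<alpha> j * t"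
    using Z_eq B_pos AE_space
  proof eventually_elim
    case (elim \<omega>)
    have "ln (Z s \<omega>) = - ln (B j s \<omega>) - \<tau> j 0 \<omega> - \<alpha> j * s" if "0 \<le> s" for s
    proof -
      have "\<tau> j s \<omega> = \<tau> j 0 \<omega> + \<alpha> j * s"
        using \<tau> that elim(3) by blast
      moreover have "B j s \<omega> > 0" and "Z s \<omega> = inverse (B j s \<omega>) * exp (- \<tau> j s \<omega>)"
        using elim that by auto
      ultimately show ?thesis
        by (simp add: ln_mult ln_inverse)
    qed
    from this[of 0] this[OF assms(4)]
    have "ln (Z 0 \<omega>) - ln (Z t \<omega>) - \<alpha> j * t = ln (B j t \<omega>) - ln (B j 0 \<omega>)"
      by simp
    moreover have "0 < B j t \<omega>" "0 < B j 0 \<omega>"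
      using elim(2) assms(4) by auto
    ultimately show ?case
      by (simp add: ln_div)
  qed
  then have "(\<integral>\<omega>. ln (B j t \<omega> / B j 0 \<omega>) \<partial>M) = (\<integral>\<omega>. ln (Z 0 \<omega>) - ln (Z t \<omega>) - \<alpha> j * t \<partial>M)"
    using B_meas[OF assms(4)] B_meas[of 0] Z_meas[OF assms(4)] Z_meas[of 0]
    by (intro integral_cong_AE) auto
  also have "\<dots> = - \<alpha> j * t"
    using int_0 int_t stationary_process_comp(2)[OF stat assms(4), of ln] by (simp add: prob_space)
  finally show ?thesis .
qed

corollary relative_entropy_eq:
  assumes "usual_filtered_prob_space M F"
    and "entropy_maximizing_basis_market M F W n \<alpha> \<theta> B \<tau> Y" "0 \<le> t"
  shows "relative_entropy M n B t = - t * (\<Sum>j=1..n. \<alpha> j)"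
  using expected_log_growth[OF assms(1,2) _ assms(3)]
  by (simp add: relative_entropy_def sum_negf sum_distrib_left mult.commute)

text \<open>The Cauchy-Schwarz inequality between the vector of the \<open>sqrt (\<alpha> j)\<close> and the vector of ones.\<close>

lemma market_activity_le_mean:
  assumes "\<And>j. j \<in> {1..n} \<Longrightarrow> 0 \<le> \<alpha> j"
  shows "real n * market_activity n \<alpha> \<le> (\<Sum>j=1..n. \<alpha> j)"
proof (cases "n = 0")
  case False
  have "(\<Sum>j=1..n. sqrt (\<alpha> j))\<^sup>2 \<le> real n * (\<Sum>j=1..n. (sqrt (\<alpha> j))\<^sup>2)"
    using Cauchy_Schwarz_ineq_sum[of "\<lambda>_. 1" "\<lambda>j. sqrt (\<alpha> j)" "{1..n}"] by simp
  also have "(\<Sum>j=1..n. (sqrt (\<alpha> j))\<^sup>2) = (\<Sum>j=1..n. \<alpha> j)"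
    using assms by (intro sum.cong) auto
  finally show ?thesis
    using False by (simp add: market_activity_def power_mult_distrib power2_eq_square field_simps)
qed simp

lemma constant_activities_mem:
  assumes "n \<ge> 1" "a > 0"
  shows "(\<lambda>j\<in>{1..n}. a) \<in> activity_vectors n a"
  using assms by (auto simp: activity_vectors_def market_activity_def)

theorem theorem4p1:
  fixes M :: "'w measure" and F :: "real \<Rightarrow> 'w measure"
    and W :: "nat \<Rightarrow> real \<Rightarrow> 'w \<Rightarrow> real"
    and n :: nat and a t :: real
    and \<theta> B \<tau> Y :: "(nat \<Rightarrow> real) \<Rightarrow> nat \<Rightarrow> real \<Rightarrow> 'w \<Rightarrow> real"
  assumes "usual_filtered_prob_space M F"
    and "standard_brownian_motions M F n W"
    and "n \<ge> 1" and "a > 0" and "t > 0"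
    and "\<And>\<alpha>. \<alpha> \<in> activity_vectors n a \<Longrightarrow>
           entropy_maximizing_basis_market M F W n \<alpha> (\<theta> \<alpha>) (B \<alpha>) (\<tau> \<alpha>) (Y \<alpha>)"
  shows "is_arg_max (\<lambda>\<alpha>. relative_entropy M n (B \<alpha>) t) (\<lambda>\<alpha>. \<alpha> \<in> activity_vectors n a)
           (\<lambda>j\<in>{1..n}. a)
       \<and> relative_entropy M n (B (\<lambda>j\<in>{1..n}. a)) t = - real n * a * t"
proof -
  have H: "relative_entropy M n (B \<alpha>) t = - t * (\<Sum>j=1..n. \<alpha> j)" if "\<alpha> \<in> activity_vectors n a" for \<alpha>
    using assms(5) by (intro relative_entropy_eq[OF assms(1) assms(6)[OF that]]) simp
  note const = constant_activities_mem[OF assms(3,4)]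
  have value_const: "relative_entropy M n (B (\<lambda>j\<in>{1..n}. a)) t = - real n * a * t"
    using H[OF const] by simp
  have "relative_entropy M n (B \<alpha>) t \<le> - real n * a * t" if "\<alpha> \<in> activity_vectors n a" for \<alpha>
  proof -
    have "0 \<le> \<alpha> j" if "j \<in> {1..n}" for j
      using \<open>\<alpha> \<in> activity_vectors n a\<close> PiE_mem[of \<alpha> "{1..n}" "\<lambda>_. {0<..}" j] that
      by (simp add: activity_vectors_def)
    then have "real n * a \<le> (\<Sum>j=1..n. \<alpha> j)"
      using market_activity_le_mean[of n \<alpha>] that by (simp add: activity_vectors_def)
    then have "t * (real n * a) \<le> t * (\<Sum>j=1..n. \<alpha> j)"
      using assms(5) by (intro mult_left_mono) auto
    then show ?thesis
      using H[OF that] by (simp add: mult_ac)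
  qed
  then show ?thesis
    using const value_const by (auto simp: is_arg_max_def not_less)
qed

end
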